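(* Let $0<p<1$ and $q=1-p$. Consider random recursive tree growth algorithms with uniform attachment insertion (probability $p$) and a deletion rule (probability $q$) given by deletion matrices $\boldsymbol{Q}_{k+1,k}$, $k\ge0$. If for every $k\ge 0$ all column sums of $\boldsymbol{Q}_{k+1,k}$ are identical (i.e. the row vector $\boldsymbol{1}_{1\times (k+1)!}\,\boldsymbol{Q}_{k+1,k}$ is a scalar multiple of $\boldsymbol{1}_{1\times k!}$, where $\boldsymbol 1_{1\times m}$ is the all-ones row vector of length $m$), then the growth algorithm supports conditional equiprobability. Conversely, every growth algorithm of this kind that supports conditional equiprobability has this property for every $k\ge0$, so this criterion describes the class of conditionally equiprobable growth algorithms. Finally, this class is nonempty.
   Context: A recursive tree with $m$ nodes is a rooted tree with nodes labeled $1,\dots,m$, rooted at node $1$, whose labels increase along every path away from the root. The size of a tree is its number of nodes; its stratum number is its size minus one. Stratum $k$ is the set of all recursive trees with stratum number $k$; it contains $k!$ trees, listed in some fixed order. A growth algorithm is the following Markov chain $(T_n)_{n\ge0}$ on recursive trees. $T_0$ is the single-node tree. At each step, with probability $p$ a node is inserted: from a stratum $k$ tree, a new node labeled $k+2$ is attached as a child of one of the $k+1$ existing nodes chosen uniformly at random (uniform attachment). With probability $q=1-p$ a deletion takes place: a stratum $k+1$ tree is replaced by a stratum $k$ tree (a node is removed and the remaining nodes are reattached and relabeled to form a recursive tree); if the current tree is the single-node tree, it is left unchanged. A deletion rule is a specification, for each $k\ge 0$, of the $(k+1)!\times k!$ nonnegative matrix $\boldsymbol{Q}_{k+1,k}$,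 whose $(s,t)$ entry is the one-step probability of moving from the stratum $k+1$ tree $s$ to the stratum $k$ tree $t$ (each row of $\boldsymbol{Q}_{k+1,k}$ sums to $q$). Let $S_n$ be the stratum number of $T_n$. The algorithm supports conditional equiprobability if for every $n\ge1$, every $k$ with $\mathbb{P}\{S_n=k\}>0$ and every stratum $k$ tree $t$, $\mathbb{P}\{T_n=t\mid S_n=k\}=1/k!$. *)

theory Defs
  imports "HOL-Probability.Probability"
begin

text \<open>A labeled graph whose arcs are meant to point from parent to child.\<close>

datatype labeled_tree = Tree (nodes: "nat set") (arcs: "(nat \<times> nat) set")

definition rooted_tree :: "labeled_tree \<Rightarrow> nat \<Rightarrow> bool" where
  "rooted_tree t r \<longleftrightarrow>
     finite (nodes t) \<and> r \<in> nodes t \<and> arcs t \<subseteq> nodes t \<times> nodes t \<and>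
     (\<forall>u. (u, r) \<notin> arcs t) \<and>
     (\<forall>v\<in>nodes t - {r}. \<exists>!u. (u, v) \<in> arcs t) \<and>
     (\<forall>v\<in>nodes t. (r, v) \<in> (arcs t)\<^sup>*)"

text \<open>Directed paths are exactly the paths leading away from the root, so the condition on
  the transitive closure says that labels increase along all of these.\<close>

definition recursive_tree :: "labeled_tree \<Rightarrow> bool" where
  "recursive_tree t \<longleftrightarrow>
     (\<exists>m. nodes t = {1..m}) \<and> rooted_tree t 1 \<and> (\<forall>(u, v)\<in>(arcs t)\<^sup>+. u < v)"

definition tree_size :: "labeled_tree \<Rightarrow> nat" where
  "tree_size t = card (nodes t)"

definition stratum_number :: "labeled_tree \<Rightarrow> nat" where
  "stratum_number t = tree_size t - 1"

definition stratum :: "nat \<Rightarrow> labeled_tree set" where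
  "stratum k = {t. recursive_tree t \<and> stratum_number t = k}"

definition single_node :: labeled_tree where
  "single_node = Tree {1} {}"

definition attach :: "labeled_tree \<Rightarrow> nat \<Rightarrow> labeled_tree" where
  "attach s v =
     (let new = stratum_number s + 2
      in Tree (insert new (nodes s)) (insert (v, new) (arcs s)))"

definition uniform_attachment :: "labeled_tree \<Rightarrow> labeled_tree pmf" where
  "uniform_attachment s = map_pmf (attach s) (pmf_of_set (nodes s))"

text \<open>The matrix \<open>Q\<^sub>k\<^sub>+\<^sub>1\<^sub>,\<^sub>k\<close> is \<open>Q k\<close>, with rows and columns indexed by the trees
  themselves: the row index ranges over stratum \<open>k + 1\<close> and the column index over stratum \<open>k\<close>.
  Values of \<open>Q k\<close> outside this range are never used.\<close>

type_synonym deletion_matrices = "nat \<Rightarrow> labeled_tree \<Rightarrow> labeled_tree \<Rightarrow> real"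

definition deletion_rule :: "real \<Rightarrow> deletion_matrices \<Rightarrow> bool" where
  "deletion_rule q Q \<longleftrightarrow>
     (\<forall>k. \<forall>s\<in>stratum (k + 1).
        (\<forall>t\<in>stratum k. 0 \<le> Q k s t) \<and> (\<Sum>t\<in>stratum k. Q k s t) = q)"

definition deletion_prob ::
    "real \<Rightarrow> deletion_matrices \<Rightarrow> labeled_tree \<Rightarrow> labeled_tree \<Rightarrow> real" where
  "deletion_prob q Q s t =
     (case stratum_number s of
        0 \<Rightarrow> (if t = s then q else 0)
      | Suc k \<Rightarrow> (if t \<in> stratum k then Q k s t else 0))"

definition transition_prob ::
    "real \<Rightarrow> real \<Rightarrow> deletion_matrices \<Rightarrow> labeled_tree \<Rightarrow> labeled_tree \<Rightarrow> real" where
  "transition_prob p q Q s t = p * pmf (uniform_attachment s) t + deletion_prob q Q s t"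

text \<open>\<open>T\<close> is a Markov chain on the recursive trees, on the probability space \<open>M\<close>, started in the
  single-node tree and with the transition probabilities above.\<close>

definition growth_algorithm ::
    "real \<Rightarrow> real \<Rightarrow> deletion_matrices \<Rightarrow> 'a measure \<Rightarrow> (nat \<Rightarrow> 'a \<Rightarrow> labeled_tree) \<Rightarrow> bool" where
  "growth_algorithm p q Q M T \<longleftrightarrow>
     prob_space M \<and>
     (\<forall>n. T n \<in> M \<rightarrow>\<^sub>M count_space {t. recursive_tree t}) \<and>
     (AE \<omega> in M. T 0 \<omega> = single_node) \<and>
     (\<forall>n x y. recursive_tree y \<longrightarrow> \<P>(\<omega> in M. \<forall>i\<le>n. T i \<omega> = x i) > 0 \<longrightarrow>
        \<P>(\<omega> in M. T (Suc n) \<omega> = y \<bar> \<forall>i\<le>n. T i \<omega> = x i) = transition_prob p q Q (x n) y)"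

definition conditionally_equiprobable :: "'a measure \<Rightarrow> (nat \<Rightarrow> 'a \<Rightarrow> labeled_tree) \<Rightarrow> bool" where
  "conditionally_equiprobable M T \<longleftrightarrow>
     (\<forall>n\<ge>1. \<forall>k. \<P>(\<omega> in M. stratum_number (T n \<omega>) = k) > 0 \<longrightarrow>
        (\<forall>t\<in>stratum k. \<P>(\<omega> in M. T n \<omega> = t \<bar> stratum_number (T n \<omega>) = k) = 1 / fact k))"

definition equal_column_sums :: "deletion_matrices \<Rightarrow> nat \<Rightarrow> bool" where
  "equal_column_sums Q k \<longleftrightarrow> (\<exists>c. \<forall>t\<in>stratum k. (\<Sum>s\<in>stratum (k + 1). Q k s t) = c)"

end

theory Submission
  imports Defs
begin

text \<open>
  Write \<open>a\<^sub>n(t)\<close> for the probability of \<open>T\<^sub>n = t\<close>. A tree \<open>t\<close> of stratum \<open>k + 1\<close> arises by insertion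
  only from the tree \<open>t'\<close> obtained by removing its largest label, so that
  \<open>a\<^sub>n\<^sub>+\<^sub>1(t) = a\<^sub>n(t') p / (k + 1) + (\<Sum>s. a\<^sub>n(s) Q\<^sub>k\<^sub>+\<^sub>2\<^sub>,\<^sub>k\<^sub>+\<^sub>1(s, t))\<close>, where \<open>s\<close> ranges over stratum
  \<open>k + 2\<close>. If all column sums agree, then by induction on \<open>n\<close> each \<open>a\<^sub>n\<close> is constant on every
  stratum. Conversely, if every \<open>a\<^sub>n\<close> with \<open>n \<ge> 1\<close> is constant on strata, the recursion at \<open>n = k + 2\<close>,
  where \<open>a\<^sub>n > 0\<close> on stratum \<open>n\<close>, exhibits the column sum as a quantity that does not depend on \<open>t\<close>.
  Replacing the current tree by a uniformly chosen tree of the stratum below has constant columns,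
  and the Ionescu-Tulcea theorem provides a Markov chain with this deletion rule.
\<close>

section \<open>Recursive trees and attachment\<close>

text \<open>Both closure conditions are local. Labels that increase along arcs increase along paths,
  and passing from a node to its parent lowers the label until node 1 is reached, so every node is
  reachable from the root.\<close>

lemma recursive_tree_iff:
  "recursive_tree t \<longleftrightarrow> (\<exists>m\<ge>1. nodes t = {1..m} \<and> arcs t \<subseteq> {1..m} \<times> {1..m} \<and>
     (\<forall>(u, v)\<in>arcs t. u < v) \<and> (\<forall>v\<in>{2..m}. \<exists>!u. (u, v) \<in> arcs t))"
proof
  assume t: "recursive_tree t"
  then obtain m where m: "nodes t = {1..m}" and r: "rooted_tree t 1"
    and lt: "\<forall>(u, v)\<in>(arcs t)\<^sup>+. u < v"
    by (auto simp: recursive_tree_def)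
  have "1 \<in> {1..m}" and "arcs t \<subseteq> {1..m} \<times> {1..m}"
    and "\<forall>v\<in>{1..m} - {1}. \<exists>!u. (u, v) \<in> arcs t"
    using r m by (auto simp: rooted_tree_def)
  moreover have "{1..m} - {1} = {2..m}" by auto
  moreover have "\<forall>(u, v)\<in>arcs t. u < v" using lt by auto
  ultimately show "\<exists>m\<ge>1. nodes t = {1..m} \<and> arcs t \<subseteq> {1..m} \<times> {1..m} \<and>
     (\<forall>(u, v)\<in>arcs t. u < v) \<and> (\<forall>v\<in>{2..m}. \<exists>!u. (u, v) \<in> arcs t)"
    using m by (intro exI[of _ m]) auto
next
  assume "\<exists>m\<ge>1. nodes t = {1..m} \<and> arcs t \<subseteq> {1..m} \<times> {1..m} \<and>
     (\<forall>(u, v)\<in>arcs t. u < v) \<and> (\<forall>v\<in>{2..m}. \<exists>!u. (u, v) \<in> arcs t)"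
  then obtain m where m: "m \<ge> 1" "nodes t = {1..m}" "arcs t \<subseteq> {1..m} \<times> {1..m}"
    and lt: "\<forall>(u, v)\<in>arcs t. u < v" and ex: "\<forall>v\<in>{2..m}. \<exists>!u. (u, v) \<in> arcs t"
    by auto
  have "u < v" if "(u, v) \<in> (arcs t)\<^sup>+" for u v
    using that by (induction rule: trancl_induct) (use lt in fastforce)+
  moreover have "(1, v) \<in> (arcs t)\<^sup>*" if "v \<in> {1..m}" for v
    using that
  proof (induction v rule: less_induct)
    case (less v)
    show ?case
    proof (cases "v = 1")
      case False
      with less.prems ex obtain u where u: "(u, v) \<in> arcs t" by force
      with lt m(3) have "u < v" "u \<in> {1..m}" by auto
      from rtrancl_into_rtrancl[OF less.IH[OF this] u] show ?thesis .
    qed simp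
  qed
  \<comment> \<open>An arc into 1 would have to start at a label below 1, outside
    \<open>{1..m}\<close>.\<close>
  moreover have "(u, 1) \<notin> arcs t" for u
    using lt m(3) by fastforce
  moreover have "{1..m} - {1} = {2..m}" by auto
  ultimately show "recursive_tree t"
    unfolding recursive_tree_def rooted_tree_def using m ex by auto
qed

lemma mem_stratum_iff:
  "t \<in> stratum k \<longleftrightarrow> nodes t = {1..k + 1} \<and> arcs t \<subseteq> {1..k + 1} \<times> {1..k + 1} \<and>
     (\<forall>(u, v)\<in>arcs t. u < v) \<and> (\<forall>v\<in>{2..k + 1}. \<exists>!u. (u, v) \<in> arcs t)" (is "_ \<longleftrightarrow> ?R")
proof
  assume "t \<in> stratum k"
  then obtain m where "m \<ge> 1" "nodes t = {1..m}" "arcs t \<subseteq> {1..m} \<times> {1..m}"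
     "\<forall>(u, v)\<in>arcs t. u < v" "\<forall>v\<in>{2..m}. \<exists>!u. (u, v) \<in> arcs t" "card (nodes t) - 1 = k"
    unfolding stratum_def recursive_tree_iff stratum_number_def tree_size_def by blast
  moreover from this have "m = k + 1" by simp
  ultimately show ?R by simp
next
  assume ?R
  then have "recursive_tree t" "card (nodes t) - 1 = k"
    unfolding recursive_tree_iff by (auto intro!: exI[of _ "k + 1"])
  then show "t \<in> stratum k"
    by (simp add: stratum_def stratum_number_def tree_size_def)
qed

lemma stratum_numberD: "t \<in> stratum k \<Longrightarrow> stratum_number t = k"
  by (simp add: stratum_def)

lemma recursive_treeD: "t \<in> stratum k \<Longrightarrow> recursive_tree t"
  by (simp add: stratum_def)

lemma recursive_tree_stratum: "recursive_tree t \<Longrightarrow> t \<in> stratum (stratum_number t)"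
  by (simp add: stratum_def)

lemma finite_stratum: "finite (stratum k)"
proof (rule finite_subset)
  show "stratum k \<subseteq> Tree {1..k + 1} ` Pow ({1..k + 1} \<times> {1..k + 1})"
  proof
    fix t assume "t \<in> stratum k"
    then show "t \<in> Tree {1..k + 1} ` Pow ({1..k + 1} \<times> {1..k + 1})"
      by (cases t) (simp add: mem_stratum_iff)
  qed
qed simp

lemma stratum_0: "stratum 0 = {single_node}"
proof -
  have "t \<in> stratum 0 \<longleftrightarrow> t = single_node" for t
    by (cases t) (auto simp: mem_stratum_iff single_node_def)
  then show ?thesis by auto
qed

text \<open>Allows the law of the chain to be computed by sums over trees and over finite
  histories.\<close>

lemma countable_recursive_trees: "countable {t. recursive_tree t}"
proof -
  have "{t. recursive_tree t} = (\<Union>k. stratum k)"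
    by (auto simp: stratum_def)
  then show ?thesis
    by (simp add: countable_finite finite_stratum)
qed

section \<open>Attachment as a bijection onto the next stratum\<close>

lemma attach_stratum:
  assumes "t \<in> stratum k"
  shows "attach t v = Tree (insert (k + 2) (nodes t)) (insert (v, k + 2) (arcs t))"
  using assms by (simp add: attach_def stratum_numberD)

lemma attach_in_stratum:
  assumes t: "t \<in> stratum k" and v: "v \<in> {1..k + 1}"
  shows "attach t v \<in> stratum (Suc k)"
proof -
  from t have n: "nodes t = {1..k + 1}" and a: "arcs t \<subseteq> {1..k + 1} \<times> {1..k + 1}"
    and lt: "\<forall>(u, v)\<in>arcs t. u < v" and ex: "\<forall>v\<in>{2..k + 1}. \<exists>!u. (u, v) \<in> arcs t"
    by (simp_all add: mem_stratum_iff)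
  have "\<exists>!u. (u, w) \<in> insert (v, k + 2) (arcs t)" if "w \<in> {2..k + 2}" for w
  proof (cases "w = k + 2")
    case True
    with a have "(u, w) \<notin> arcs t" for u by auto
    with True show ?thesis by auto
  next
    case False
    with that ex have "\<exists>!u. (u, w) \<in> arcs t" by auto
    with False show ?thesis by simp
  qed
  moreover have "insert (k + 2) {1..k + 1} = {1..Suc k + 1}" by auto
  ultimately show ?thesis
    unfolding attach_stratum[OF t] mem_stratum_iff using n a lt v by auto
qed

text \<open>Label \<open>k + 2\<close> occurs in no arc of a stratum \<open>k\<close> tree. Hence
  the only arc into it in \<open>attach t v\<close> reveals \<open>v\<close>, and deleting that arc
  gives back \<open>t\<close>.\<close>

lemma inj_on_attach: "inj_on (\<lambda>(t, v). attach t v) (stratum k \<times> {1..k + 1})"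
proof (rule inj_onI, clarify)
  fix s v t w
  assume st: "s \<in> stratum k" "t \<in> stratum k" and eq: "attach s v = attach t w"
  have notin: "(x, k + 2) \<notin> arcs r" if "r \<in> stratum k" for x r
    using that by (auto simp: mem_stratum_iff)
  from st eq have arcs: "insert (v, k + 2) (arcs s) = insert (w, k + 2) (arcs t)"
    by (simp add: attach_stratum)
  with st(2) notin have "v = w" by blast
  moreover from this arcs st notin have "arcs s = arcs t"
    by (metis insert_ident)
  ultimately show "s = t \<and> v = w"
    using st by (cases s; cases t) (auto simp: mem_stratum_iff)
qed

text \<open>Since labels increase away from the root, the largest label is a leaf. Removing it with
  its incoming arc leaves a tree of the stratum below, and attaching it again at its former parent
  restores the tree.\<close>

lemma stratum_Suc_eq_attach:
  "stratum (Suc k) = (\<lambda>(t, v). attach t v) ` (stratum k \<times> {1..k + 1})"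
proof (intro equalityI subsetI)
  fix y assume "y \<in> stratum (Suc k)"
  then have n: "nodes y = {1..k + 2}" and a: "arcs y \<subseteq> {1..k + 2} \<times> {1..k + 2}"
    and lt: "\<forall>(u, v)\<in>arcs y. u < v" and ex: "\<forall>v\<in>{2..k + 2}. \<exists>!u. (u, v) \<in> arcs y"
    by (simp_all add: mem_stratum_iff)
  from ex obtain v where v: "(v, k + 2) \<in> arcs y" and uniq: "\<And>u. (u, k + 2) \<in> arcs y \<Longrightarrow> u = v"
    by force
  from v lt a have v': "v \<in> {1..k + 1}" by auto
  define t where "t = Tree {1..k + 1} (arcs y - {(v, k + 2)})"
  \<comment> \<open>No other arc touches \<open>k + 2\<close>: an arc into it would give a second
    parent, an arc out of it would need a larger label.\<close>
  have "u \<le> k + 1 \<and> w \<le> k + 1" if "(u, w) \<in> arcs y" "(u, w) \<noteq> (v, k + 2)" for u w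
  proof -
    from that uniq have "w \<noteq> k + 2" by auto
    moreover from that a lt have "u < w" "w \<le> k + 2" by auto
    ultimately show ?thesis by simp
  qed
  moreover from a have "1 \<le> u \<and> 1 \<le> w" if "(u, w) \<in> arcs y" for u w
    using that by auto
  ultimately have "arcs y - {(v, k + 2)} \<subseteq> {1..k + 1} \<times> {1..k + 1}"
    unfolding subset_iff mem_Times_iff atLeastAtMost_iff by (metis Diff_iff prod.collapse singletonI)
  moreover have "\<exists>!u. (u, w) \<in> arcs y - {(v, k + 2)}" if "w \<in> {2..k + 1}" for w
  proof -
    from that ex have "\<exists>!u. (u, w) \<in> arcs y" by simp
    with that show ?thesis by simp
  qed
  ultimately have t: "t \<in> stratum k"
    unfolding t_def mem_stratum_iff using lt by simp
  have "insert (k + 2) {1..k + 1} = {1..k + 2}" by auto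
  with v n have "Tree (insert (k + 2) (nodes t)) (insert (v, k + 2) (arcs t)) = Tree (nodes y) (arcs y)"
    by (simp add: t_def insert_absorb del: One_nat_def)
  then have "attach t v = y"
    by (simp add: attach_stratum[OF t])
  with t v' show "y \<in> (\<lambda>(t, v). attach t v) ` (stratum k \<times> {1..k + 1})"
    by (intro image_eqI[of _ _ "(t, v)"]) auto
qed (use attach_in_stratum in auto)

lemma card_stratum: "card (stratum k) = fact k"
proof (induction k)
  case (Suc k)
  have "card (stratum (Suc k)) = card (stratum k \<times> {1..k + 1})"
    unfolding stratum_Suc_eq_attach by (rule card_image[OF inj_on_attach])
  with Suc show ?case by (simp add: card_cartesian_product)
qed (simp add: stratum_0)

lemma stratum_nonempty: "stratum k \<noteq> {}"
  using card_stratum[of k] by (metis card.empty fact_nonzero)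

text \<open>Inverse of attachment that keeps the tree and forgets the attachment point. It is
  meaningful on positive strata, where injectivity of attachment makes the description
  unique.\<close>

definition prune :: "labeled_tree \<Rightarrow> labeled_tree" where
  "prune y = (THE t. t \<in> stratum (stratum_number y - 1) \<and> (\<exists>v\<in>nodes t. attach t v = y))"

lemma prune_attach:
  assumes t: "t \<in> stratum k" and v: "v \<in> {1..k + 1}"
  shows "prune (attach t v) = t"
proof -
  have "stratum_number (attach t v) - 1 = k"
    using stratum_numberD[OF attach_in_stratum[OF t v]] by simp
  moreover have "nodes s = {1..k + 1}" if "s \<in> stratum k" for s
    using that by (simp add: mem_stratum_iff)
  ultimately show ?thesis
    unfolding prune_def using t v inj_on_attach[of k]
    by (intro the_equality) (auto simp: inj_on_def)
qed

lemma prune_in_stratum: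
  assumes "y \<in> stratum (Suc k)"
  shows "prune y \<in> stratum k"
proof -
  from assms obtain t v where "t \<in> stratum k" "v \<in> {1..k + 1}" "y = attach t v"
    unfolding stratum_Suc_eq_attach by fast
  then show ?thesis using prune_attach by simp
qed

section \<open>Transition probabilities between strata\<close>

lemma set_pmf_uniform_attachment:
  assumes "t \<in> stratum k"
  shows "set_pmf (uniform_attachment t) \<subseteq> stratum (Suc k)"
proof -
  have "nodes t = {1..k + 1}" using assms by (simp add: mem_stratum_iff)
  then show ?thesis
    using attach_in_stratum[OF assms] by (auto simp: uniform_attachment_def simp del: One_nat_def)
qed

text \<open>Exactly one pair of a tree and an attachment point produces \<open>y\<close>, so the
  uniform choice among \<open>k + 1\<close> nodes hits \<open>y\<close> with one node if
  \<open>t\<close> is \<open>prune y\<close>, and with none otherwise.\<close>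

lemma pmf_uniform_attachment:
  assumes t: "t \<in> stratum k" and y: "y \<in> stratum (Suc k)"
  shows "pmf (uniform_attachment t) y = (if t = prune y then 1 / (k + 1) else 0)"
proof -
  have n: "nodes t = {1..k + 1}" using t by (simp add: mem_stratum_iff)
  from y obtain s v where s: "s \<in> stratum k" "v \<in> {1..k + 1}" "y = attach s v"
    unfolding stratum_Suc_eq_attach by fast
  then have p: "prune y = s" using prune_attach by blast
  have "pmf (uniform_attachment t) y = card ({1..k + 1} \<inter> attach t -` {y}) / (k + 1)"
    unfolding uniform_attachment_def pmf_map n
    by (subst measure_pmf_of_set) auto
  also have "{1..k + 1} \<inter> attach t -` {y} = (if t = s then {v} else {})"
  proof -
    have "t = s \<and> w = v" if "1 \<le> w" "w \<le> k + 1" "attach t w = y" for w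
      using inj_onD[OF inj_on_attach[of k], of "(t, w)" "(s, v)"] s t that by simp
    with s show ?thesis by auto
  qed
  finally show ?thesis using p by simp
qed

text \<open>Insertion moves up one stratum and deletion moves down one, so the two terms never
  overlap. The last branch is the step that leaves the single-node tree in place.\<close>

lemma transition_prob_strata:
  assumes x: "x \<in> stratum j" and y: "y \<in> stratum k"
  shows "transition_prob p q Q x y =
    (if k = Suc j then if x = prune y then p / (j + 1) else 0
     else if j = Suc k then Q k x y else if j = k \<and> k = 0 then q else 0)"
proof -
  have "pmf (uniform_attachment x) y =
      (if k = Suc j then if x = prune y then 1 / (j + 1) else 0 else 0)"
  proof (cases "k = Suc j")
    case False
    then have "y \<notin> stratum (Suc j)" using y by (auto simp: stratum_def)
    with set_pmf_uniform_attachment[OF x] have "y \<notin> set_pmf (uniform_attachment x)" by auto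
    with False show ?thesis by (simp add: pmf_eq_0_set_pmf)
  qed (use x y pmf_uniform_attachment in simp)
  moreover have "deletion_prob q Q x y =
      (if j = Suc k then Q k x y else if j = k \<and> k = 0 then q else 0)"
  proof (cases j)
    case 0
    with x have "x = single_node" by (simp add: stratum_0)
    moreover have "y = single_node \<longleftrightarrow> k = 0"
      using y stratum_0 by (auto simp: stratum_def)
    ultimately show ?thesis
      using 0 stratum_numberD[OF x] by (simp add: deletion_prob_def)
  next
    case (Suc i)
    with y show ?thesis
      by (auto simp: deletion_prob_def stratum_numberD[OF x] stratum_def)
  qed
  ultimately show ?thesis by (auto simp: transition_prob_def)
qed

section \<open>One-step recursion and column sums\<close>

locale growth_chain =
  fixes p q :: real and Q :: deletion_matrices and M :: "'a measure"
    and T :: "nat \<Rightarrow> 'a \<Rightarrow> labeled_tree"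
  assumes rule: "deletion_rule q Q" and growth: "growth_algorithm p q Q M T"
    and p_pos: "0 < p" and q_nonneg: "0 \<le> q"
begin

sublocale prob_space M
  using growth by (simp add: growth_algorithm_def)

lemma measurable_T [measurable]: "T n \<in> M \<rightarrow>\<^sub>M count_space {t. recursive_tree t}"
  using growth by (simp add: growth_algorithm_def)

lemma recursive_tree_T: "\<omega> \<in> space M \<Longrightarrow> recursive_tree (T n \<omega>)"
  using measurable_space[OF measurable_T] by simp

lemma sets_T_eq [measurable]: "{\<omega> \<in> space M. T n \<omega> = t} \<in> sets M"
proof -
  \<comment> \<open>The intersection also covers a \<open>t\<close> that is not a recursive tree,
    for which the event is empty.\<close>
  have "T n -` ({t} \<inter> {t. recursive_tree t}) \<inter> space M \<in> sets M"
    by (rule measurable_sets[OF measurable_T]) simp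
  also have "T n -` ({t} \<inter> {t. recursive_tree t}) \<inter> space M = {\<omega> \<in> space M. T n \<omega> = t}"
    using recursive_tree_T by auto
  finally show ?thesis .
qed

definition tree_prob :: "nat \<Rightarrow> labeled_tree \<Rightarrow> real" where
  "tree_prob n t = prob {\<omega> \<in> space M. T n \<omega> = t}"

lemma tree_prob_nonneg: "0 \<le> tree_prob n t"
  by (simp add: tree_prob_def)

lemma deletion_nonneg: "s \<in> stratum (Suc k) \<Longrightarrow> t \<in> stratum k \<Longrightarrow> 0 \<le> Q k s t"
  using rule by (simp add: deletion_rule_def)

lemma transition_prob_nonneg:
  assumes "recursive_tree x" "recursive_tree y"
  shows "0 \<le> transition_prob p q Q x y"
proof -
  obtain j k where x: "x \<in> stratum j" and y: "y \<in> stratum k"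
    using assms recursive_tree_stratum by blast
  show ?thesis
    unfolding transition_prob_strata[OF x y]
    using x y p_pos q_nonneg deletion_nonneg[of x k y] by auto
qed

section \<open>One-step law of the chain\<close>

text \<open>The Markov property in product form. It extends to histories of probability zero, where
  both sides vanish.\<close>

lemma prob_history_Suc:
  assumes y: "recursive_tree y"
  shows "prob {\<omega> \<in> space M. (\<forall>i\<le>n. T i \<omega> = x i) \<and> T (Suc n) \<omega> = y} =
    prob {\<omega> \<in> space M. \<forall>i\<le>n. T i \<omega> = x i} * transition_prob p q Q (x n) y"
proof (cases "prob {\<omega> \<in> space M. \<forall>i\<le>n. T i \<omega> = x i} > 0")
  case True
  have "cond_prob M (\<lambda>\<omega>. T (Suc n) \<omega> = y) (\<lambda>\<omega>. \<forall>i\<le>n. T i \<omega> = x i) =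
      transition_prob p q Q (x n) y"
    using growth y True unfolding growth_algorithm_def by blast
  with True show ?thesis
    by (simp add: cond_prob_def conj_commute field_simps)
next
  case False
  then have *: "prob {\<omega> \<in> space M. \<forall>i\<le>n. T i \<omega> = x i} = 0"
    by (simp add: zero_less_measure_iff)
  have "prob {\<omega> \<in> space M. (\<forall>i\<le>n. T i \<omega> = x i) \<and> T (Suc n) \<omega> = y} \<le>
      prob {\<omega> \<in> space M. \<forall>i\<le>n. T i \<omega> = x i}"
    by (rule finite_measure_mono) auto
  with * show ?thesis by (simp add: measure_le_0_iff)
qed

text \<open>Sum over the countably many histories that end in \<open>x\<close>: the transition
  factor depends only on this last tree and leaves the sum.\<close>

lemma prob_pair:
  assumes x: "recursive_tree x" and y: "recursive_tree y"
  shows "prob {\<omega> \<in> space M. T n \<omega> = x \<and> T (Suc n) \<omega> = y} =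
    tree_prob n x * transition_prob p q Q x y"
proof -
  \<comment> \<open>Histories are taken extensional on \<open>{..n}\<close>, so that distinct ones
    differ at some time up to \<open>n\<close> and their events \<open>E h\<close> are
    disjoint.\<close>
  define H where "H = (PiE {..n} (\<lambda>_. {t. recursive_tree t})) \<inter> {h. h n = x}"
  define E where "E h = {\<omega> \<in> space M. \<forall>i\<le>n. T i \<omega> = h i}" for h
  define F where "F = {\<omega> \<in> space M. T (Suc n) \<omega> = y}"
  have H: "countable H"
    unfolding H_def by (intro countable_Int1 countable_PiE countable_recursive_trees) simp
  have E: "E h \<in> sets M" and F: "F \<in> sets M" for h
    unfolding E_def F_def by measurable
  have disj: "disjoint_family_on E H"
    unfolding disjoint_family_on_def
  proof (intro ballI impI)
    fix g h assume gh: "g \<in> H" "h \<in> H" "g \<noteq> h"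
    then obtain i where "i \<le> n" "g i \<noteq> h i"
      unfolding H_def by (metis IntD1 PiE_ext atMost_iff)
    then show "E g \<inter> E h = {}" by (auto simp: E_def)
  qed
  have Un: "(\<Union>h\<in>H. E h) = {\<omega> \<in> space M. T n \<omega> = x}"
  proof (intro equalityI subsetI)
    fix \<omega> assume \<omega>: "\<omega> \<in> {\<omega> \<in> space M. T n \<omega> = x}"
    then have "restrict (\<lambda>i. T i \<omega>) {..n} \<in> H" "\<omega> \<in> E (restrict (\<lambda>i. T i \<omega>) {..n})"
      using recursive_tree_T by (auto simp: H_def E_def)
    then show "\<omega> \<in> (\<Union>h\<in>H. E h)" by blast
  qed (auto simp: H_def E_def)
  have "{\<omega> \<in> space M. T n \<omega> = x \<and> T (Suc n) \<omega> = y} = (\<Union>h\<in>H. E h \<inter> F)"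
    using Un by (auto simp: F_def)
  also have "emeasure M \<dots> = (\<integral>\<^sup>+h. emeasure M (E h \<inter> F) \<partial>count_space H)"
    using H E F disj by (intro emeasure_UN_countable) (auto simp: disjoint_family_on_def)
  also have "\<dots> = (\<integral>\<^sup>+h. emeasure M (E h) * ennreal (transition_prob p q Q x y) \<partial>count_space H)"
  proof (rule nn_integral_cong)
    fix h assume "h \<in> space (count_space H)"
    then have "h n = x" by (simp add: H_def)
    moreover have "E h \<inter> F = {\<omega> \<in> space M. (\<forall>i\<le>n. T i \<omega> = h i) \<and> T (Suc n) \<omega> = y}"
      by (auto simp: E_def F_def)
    ultimately have "prob (E h \<inter> F) = prob (E h) * transition_prob p q Q x y"
      using prob_history_Suc[OF y, of n h] by (simp add: E_def)
    then show "emeasure M (E h \<inter> F) = emeasure M (E h) * ennreal (transition_prob p q Q x y)"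
      using transition_prob_nonneg[OF x y] by (simp add: emeasure_eq_measure ennreal_mult)
  qed
  also have "\<dots> = (\<integral>\<^sup>+h. emeasure M (E h) \<partial>count_space H) * ennreal (transition_prob p q Q x y)"
    by (rule nn_integral_multc) simp
  also have "(\<integral>\<^sup>+h. emeasure M (E h) \<partial>count_space H) = emeasure M (\<Union>h\<in>H. E h)"
    using H E disj by (intro emeasure_UN_countable[symmetric]) auto
  finally show ?thesis
    using transition_prob_nonneg[OF x y]
    by (simp add: Un tree_prob_def emeasure_eq_measure flip: ennreal_mult)
qed

text \<open>Total probability over the tree at time \<open>n\<close>. A finite set that contains all
  possible predecessors of \<open>y\<close> turns the countable sum into a finite one.\<close>

lemma tree_prob_Suc_eq_sum:
  assumes y: "recursive_tree y" and A: "finite A" "\<And>x. x \<in> A \<Longrightarrow> recursive_tree x"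
    and supp: "\<And>x. recursive_tree x \<Longrightarrow> x \<notin> A \<Longrightarrow> transition_prob p q Q x y = 0"
  shows "tree_prob (Suc n) y = (\<Sum>x\<in>A. tree_prob n x * transition_prob p q Q x y)"
proof -
  define R where "R = {t. recursive_tree t}"
  define E where "E x = {\<omega> \<in> space M. T n \<omega> = x \<and> T (Suc n) \<omega> = y}" for x
  have E: "E x \<in> sets M" for x
    unfolding E_def by measurable
  have "{\<omega> \<in> space M. T (Suc n) \<omega> = y} = (\<Union>x\<in>R. E x)"
    using recursive_tree_T by (auto simp: E_def R_def)
  also have "emeasure M \<dots> = (\<integral>\<^sup>+x. emeasure M (E x) \<partial>count_space R)"
    using E countable_recursive_trees
    by (intro emeasure_UN_countable) (auto simp: disjoint_family_on_def E_def R_def)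
  also have "\<dots> = (\<Sum>x\<in>A. emeasure M (E x))"
    using A supp prob_pair[OF _ y]
    by (intro nn_integral_count_space') (auto simp: E_def R_def emeasure_eq_measure)
  also have "\<dots> = ennreal (\<Sum>x\<in>A. prob (E x))"
    by (simp add: emeasure_eq_measure)
  also have "(\<Sum>x\<in>A. prob (E x)) = (\<Sum>x\<in>A. tree_prob n x * transition_prob p q Q x y)"
    using A prob_pair[OF _ y] by (intro sum.cong) (auto simp: E_def)
  finally show ?thesis
    using A transition_prob_nonneg[OF _ y] tree_prob_nonneg
    by (simp add: tree_prob_def[of "Suc n"] emeasure_eq_measure sum_nonneg)
qed

text \<open>Above stratum 0 there is no resting step, so the only possible predecessors of
  \<open>y\<close> are \<open>prune y\<close>, by insertion, and the trees one stratum above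
  \<open>y\<close>, by deletion.\<close>

lemma tree_prob_Suc:
  assumes y: "y \<in> stratum (Suc k)"
  shows "tree_prob (Suc n) y = tree_prob n (prune y) * (p / (k + 1)) +
    (\<Sum>s\<in>stratum (Suc (Suc k)). tree_prob n s * Q (Suc k) s y)"
proof -
  let ?A = "insert (prune y) (stratum (Suc (Suc k)))"
  have pr: "prune y \<in> stratum k" using y by (rule prune_in_stratum)
  then have notin: "prune y \<notin> stratum (Suc (Suc k))" by (simp add: stratum_def)
  have "transition_prob p q Q x y = 0" if "recursive_tree x" "x \<notin> ?A" for x
    using that transition_prob_strata[OF recursive_tree_stratum[OF that(1)] y]
    by (auto simp: stratum_def)
  then have "tree_prob (Suc n) y = (\<Sum>x\<in>?A. tree_prob n x * transition_prob p q Q x y)"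
    using y pr finite_stratum
    by (intro tree_prob_Suc_eq_sum) (auto simp: recursive_treeD)
  also have "\<dots> = tree_prob n (prune y) * transition_prob p q Q (prune y) y +
      (\<Sum>s\<in>stratum (Suc (Suc k)). tree_prob n s * transition_prob p q Q s y)"
    using notin finite_stratum by simp
  finally show ?thesis
    using transition_prob_strata[OF pr y] transition_prob_strata[OF _ y] by simp
qed

lemma tree_prob_0: "tree_prob 0 t = (if t = single_node then 1 else 0)"
proof -
  have "AE \<omega> in M. T 0 \<omega> = single_node"
    using growth by (simp add: growth_algorithm_def)
  then have "AE \<omega> in M. (\<omega> \<in> {\<omega> \<in> space M. T 0 \<omega> = t}) = (\<omega> \<in> (if t = single_node then space M else {}))"
    by (auto elim: AE_mp)
  then have "tree_prob 0 t = prob (if t = single_node then space M else {})"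
    unfolding tree_prob_def by (rule finite_measure_eq_AE) auto
  then show ?thesis by (simp add: prob_space)
qed

text \<open>Time and stratum coincide here: a run of \<open>n\<close> insertions from the
  single-node tree, through the successive prunings of \<open>t\<close>, produces \<open>t\<close>
  with positive probability.\<close>

lemma tree_prob_pos: "t \<in> stratum n \<Longrightarrow> 0 < tree_prob n t"
proof (induction n arbitrary: t)
  case 0
  then show ?case by (simp add: stratum_0 tree_prob_0)
next
  case (Suc n)
  have "0 < tree_prob n (prune t) * (p / (n + 1))"
    using Suc.IH[OF prune_in_stratum[OF Suc.prems]] p_pos by simp
  moreover have "0 \<le> (\<Sum>s\<in>stratum (Suc (Suc n)). tree_prob n s * Q (Suc n) s t)"
    using Suc.prems by (intro sum_nonneg mult_nonneg_nonneg tree_prob_nonneg deletion_nonneg)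
  ultimately show ?case unfolding tree_prob_Suc[OF Suc.prems] by linarith
qed

lemma prob_stratum:
  "prob {\<omega> \<in> space M. stratum_number (T n \<omega>) = k} = (\<Sum>t\<in>stratum k. tree_prob n t)"
proof -
  have "{\<omega> \<in> space M. stratum_number (T n \<omega>) = k} = (\<Union>t\<in>stratum k. {\<omega> \<in> space M. T n \<omega> = t})"
    using recursive_tree_T by (auto simp: stratum_def)
  then show ?thesis
    unfolding tree_prob_def
    by (simp only:, intro finite_measure_finite_Union) (auto simp: disjoint_family_on_def finite_stratum)
qed

lemma cond_prob_stratum:
  assumes "t \<in> stratum k"
  shows "cond_prob M (\<lambda>\<omega>. T n \<omega> = t) (\<lambda>\<omega>. stratum_number (T n \<omega>) = k) =
    tree_prob n t / (\<Sum>t\<in>stratum k. tree_prob n t)"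
proof -
  have "{\<omega> \<in> space M. T n \<omega> = t \<and> stratum_number (T n \<omega>) = k} = {\<omega> \<in> space M. T n \<omega> = t}"
    using stratum_numberD[OF assms] by auto
  then show ?thesis by (simp add: cond_prob_def prob_stratum tree_prob_def)
qed

section \<open>Equal column sums imply conditional equiprobability\<close>

text \<open>In the recursion, constancy on stratum \<open>j\<close> fixes the insertion term, while
  constancy on stratum \<open>j + 2\<close> lets the probability leave the deletion sum, which
  becomes a multiple of a column sum.\<close>

lemma tree_prob_constant_Suc:
  assumes eq: "\<forall>k. equal_column_sums Q k"
    and IH: "\<And>k. tree_prob n constant_on stratum k"
  shows "tree_prob (Suc n) constant_on stratum k"
proof (cases k)
  case 0
  then show ?thesis by (auto simp: stratum_0 constant_on_def)
next
  case (Suc j)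
  obtain a where a: "\<And>t. t \<in> stratum j \<Longrightarrow> tree_prob n t = a"
    using IH[of j] unfolding constant_on_def by blast
  obtain b where b: "\<And>s. s \<in> stratum (Suc (Suc j)) \<Longrightarrow> tree_prob n s = b"
    using IH[of "Suc (Suc j)"] unfolding constant_on_def by blast
  obtain c where c: "\<And>t. t \<in> stratum (Suc j) \<Longrightarrow> (\<Sum>s\<in>stratum (Suc (Suc j)). Q (Suc j) s t) = c"
    using eq[rule_format, of "Suc j"] by (auto simp: equal_column_sums_def)
  have "tree_prob (Suc n) t = a * (p / (j + 1)) + b * c" if t: "t \<in> stratum (Suc j)" for t
    unfolding tree_prob_Suc[OF t] using a[OF prune_in_stratum[OF t]] b c[OF t]
    by (simp flip: sum_distrib_left)
  with Suc show ?thesis by (auto simp: constant_on_def)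
qed

lemma tree_prob_constant:
  assumes "\<forall>k. equal_column_sums Q k"
  shows "tree_prob n constant_on stratum k"
proof (induction n arbitrary: k)
  case 0
  show ?case
  proof (cases k)
    case (Suc j)
    \<comment> \<open>The initial law is a point mass on the only tree of stratum 0, hence zero
      throughout every higher stratum.\<close>
    have "single_node \<in> stratum 0" by (simp add: stratum_0)
    with Suc have "t \<noteq> single_node" if "t \<in> stratum k" for t
      using that by (auto simp: stratum_def)
    then show ?thesis by (auto simp: constant_on_def tree_prob_0)
  qed (auto simp: constant_on_def stratum_0)
qed (use assms tree_prob_constant_Suc in blast)

lemma conditionally_equiprobable_if_equal_column_sums:
  assumes "\<forall>k. equal_column_sums Q k"
  shows "conditionally_equiprobable M T"
  unfolding conditionally_equiprobable_def
proof (intro allI ballI impI)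
  fix n k t
  assume pos: "0 < prob {\<omega> \<in> space M. stratum_number (T n \<omega>) = k}" and t: "t \<in> stratum k"
  obtain c where c: "\<And>t. t \<in> stratum k \<Longrightarrow> tree_prob n t = c"
    using tree_prob_constant[OF assms, of n k] unfolding constant_on_def by blast
  then have "(\<Sum>t\<in>stratum k. tree_prob n t) = fact k * c"
    by (simp add: card_stratum)
  \<comment> \<open>The stratum has positive probability, so \<open>c\<close> cancels from
    \<open>c / (fact k * c)\<close>.\<close>
  moreover from this pos have "c \<noteq> 0" by (auto simp: prob_stratum)
  ultimately show "cond_prob M (\<lambda>\<omega>. T n \<omega> = t) (\<lambda>\<omega>. stratum_number (T n \<omega>) = k) = 1 / fact k"
    using c t by (simp add: cond_prob_stratum)
qed

section \<open>Conditional equiprobability implies equal column sums\<close>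

text \<open>On a stratum of positive probability the common value is that probability divided by
  \<open>fact k\<close>. On a stratum of probability zero all its trees have probability zero, so
  the same formula holds.\<close>

lemma tree_prob_constant_if_conditionally_equiprobable:
  assumes "conditionally_equiprobable M T" and n: "n \<ge> 1"
  shows "tree_prob n constant_on stratum k"
proof -
  let ?S = "\<Sum>t\<in>stratum k. tree_prob n t"
  have "tree_prob n t = ?S / fact k" if t: "t \<in> stratum k" for t
  proof (cases "?S > 0")
    case True
    with assms t have "tree_prob n t / ?S = 1 / fact k"
      unfolding conditionally_equiprobable_def cond_prob_stratum[OF t, symmetric]
      by (simp add: prob_stratum)
    with True show ?thesis by (simp add: field_simps)
  next
    case False
    then have "?S = 0" by (simp add: order.antisym sum_nonneg tree_prob_nonneg)
    with t show ?thesis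
      by (simp add: sum_nonneg_eq_0_iff finite_stratum tree_prob_nonneg)
  qed
  then show ?thesis unfolding constant_on_def by blast
qed

text \<open>The one-step recursion is solved for the column sum: its other terms are constant in
  \<open>t\<close>, and the coefficient of the column sum is positive.\<close>

lemma equal_column_sums_if_conditionally_equiprobable:
  assumes "conditionally_equiprobable M T"
  shows "equal_column_sums Q k"
proof (cases k)
  case 0
  then show ?thesis by (simp add: equal_column_sums_def stratum_0)
next
  case (Suc j)
  \<comment> \<open>The time is matched with stratum \<open>k + 1\<close>, which indexes the rows of
    \<open>Q k\<close>, so that \<open>tree_prob_pos\<close> makes the common probability
    \<open>b\<close> of the row trees positive.\<close>
  define n where "n = Suc (Suc j)"
  have const: "tree_prob m constant_on stratum i" if "n \<le> m" for m i
    using that by (intro tree_prob_constant_if_conditionally_equiprobable[OF assms]) (simp add: n_def)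
  obtain a where a: "\<And>t. t \<in> stratum j \<Longrightarrow> tree_prob n t = a"
    using const[of n j] unfolding constant_on_def by auto
  obtain b where b: "\<And>s. s \<in> stratum n \<Longrightarrow> tree_prob n s = b"
    using const[of n n] unfolding constant_on_def by auto
  obtain c where c: "\<And>t. t \<in> stratum k \<Longrightarrow> tree_prob (Suc n) t = c"
    using const[of "Suc n" k] unfolding constant_on_def by auto
  have "b > 0"
    using stratum_nonempty[of n] tree_prob_pos[of _ n] b by fastforce
  have "(\<Sum>s\<in>stratum n. Q k s t) = (c - a * (p / (j + 1))) / b" if t: "t \<in> stratum k" for t
  proof -
    have "c = a * (p / (j + 1)) + b * (\<Sum>s\<in>stratum n. Q k s t)"
      using tree_prob_Suc[of t j n] t Suc a[OF prune_in_stratum[of t j]] b c[OF t]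
      by (simp add: n_def sum_distrib_left)
    then have "c - a * (p / (j + 1)) = b * (\<Sum>s\<in>stratum n. Q k s t)" by simp
    with \<open>b > 0\<close> show ?thesis by simp
  qed
  then have "\<exists>d. \<forall>t\<in>stratum k. (\<Sum>s\<in>stratum n. Q k s t) = d" by blast
  moreover have "n = k + 1" by (simp add: n_def Suc)
  ultimately show ?thesis by (simp only: equal_column_sums_def)
qed

end

section \<open>Existence of a growth algorithm\<close>

text \<open>Chain rule for a prescribed finite prefix: the event is a cylinder over the first
  \<open>n\<close> coordinates, and the measure \<open>C\<close> of the single point
  \<open>x\<close> on them is computed one kernel at a time.\<close>

lemma (in Ionescu_Tulcea) emeasure_lim_prefix:
  assumes single: "\<And>i a. a \<in> space (M i) \<Longrightarrow> {a} \<in> sets (M i)"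
    and x: "\<And>i. i < n \<Longrightarrow> x i \<in> space (M i)"
  shows "emeasure PF.lim {\<omega> \<in> space (PiM UNIV M). \<forall>i<n. \<omega> i = x i} =
    (\<Prod>i<n. emeasure (P i (restrict x {0..<i})) {x i})"
proof -
  have mem: "restrict x {0..<m} \<in> space (PiM {0..<m} M)" if "m \<le> n" for m
    using that x by (auto simp: space_PiM)
  have sets: "{restrict x {0..<m}} \<in> sets (PiM {0..<m} M)" if "m \<le> n" for m
  proof -
    have "{restrict x {0..<m}} = PiE {0..<m} (\<lambda>i. {x i})"
      by (auto simp: PiE_iff extensional_def fun_eq_iff)
    also have "\<dots> \<in> sets (PiM {0..<m} M)"
      using that x single by (intro sets_PiM_I_finite) auto
    finally show ?thesis .
  qed
  have C: "emeasure (C 0 m (\<lambda>_. undefined)) {restrict x {0..<m}} =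
      (\<Prod>i<m. emeasure (P i (restrict x {0..<i})) {x i})" if "m \<le> n" for m
    using that
  proof (induction m)
    case 0
    show ?case using sets[of 0] by (simp add: restrict_def)
  next
    case (Suc m)
    let ?r = "\<lambda>m. restrict x {0..<m}"
    \<comment> \<open>The empty product has this function as its only point; the composition of
      kernels starts there.\<close>
    have und: "(\<lambda>_. undefined) \<in> space (PiM {0..<0} M)" by simp
    have "emeasure (C 0 (Suc m) (\<lambda>_. undefined)) {?r (Suc m)} =
        (\<integral>\<^sup>+\<omega>. emeasure (eP m \<omega>) {?r (Suc m)} \<partial>C 0 m (\<lambda>_. undefined))"
      using sets[OF Suc.prems] measurable_eP[of m] prob_space_C[OF und, of m]
      by (simp, subst emeasure_bind[where N = "PiM {0..<Suc m} M"])
         (auto simp: space_C[OF und] measurable_cong_sets[OF sets_C[OF und]] prob_space.not_empty)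
    also have "\<dots> = (\<integral>\<^sup>+\<omega>. emeasure (P m (?r m)) {x m} * indicator {?r m} \<omega>
        \<partial>C 0 m (\<lambda>_. undefined))"
    proof (rule nn_integral_cong)
      fix \<omega> assume "\<omega> \<in> space (C 0 m (\<lambda>_. undefined))"
      then have \<omega>: "\<omega> \<in> space (PiM {0..<m} M)" by (simp add: space_C[OF und])
      then have ext: "\<omega> \<in> extensional {0..<m}" by (auto simp: space_PiM PiE_iff)
      \<comment> \<open>Extending a history by one coordinate gives the longer prefix only from the
        shorter prefix, so the integrand is supported on one point.\<close>
      have "fun_upd \<omega> m y = ?r (Suc m) \<longleftrightarrow> \<omega> = ?r m \<and> y = x m" for y
      proof
        assume eq: "fun_upd \<omega> m y = ?r (Suc m)"
        have "\<omega> i = ?r m i" for i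
          using fun_cong[OF eq, of i] ext by (cases "i < m") (auto simp: extensional_def)
        with fun_cong[OF eq, of m] show "\<omega> = ?r m \<and> y = x m" by auto
      qed (auto simp: fun_eq_iff)
      then have "fun_upd \<omega> m -` {?r (Suc m)} \<inter> space (M m) = (if \<omega> = ?r m then {x m} else {})"
        using x[of m] Suc.prems by (auto simp: vimage_def)
      then show "emeasure (eP m \<omega>) {?r (Suc m)} =
          emeasure (P m (?r m)) {x m} * indicator {?r m} \<omega>"
        using emeasure_eP[OF \<omega> sets[OF Suc.prems]] by (simp split: split_indicator)
    qed
    also have "\<dots> = emeasure (P m (?r m)) {x m} * emeasure (C 0 m (\<lambda>_. undefined)) {?r m}"
      using sets[of m] Suc.prems by (intro nn_integral_cmult_indicator) (simp add: sets_C[OF und])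
    also have "emeasure (C 0 m (\<lambda>_. undefined)) {?r m} =
        (\<Prod>i<m. emeasure (P i (?r i)) {x i})"
      by (rule Suc.IH[OF Suc_leD[OF Suc.prems]])
    finally show ?case
      unfolding prod.lessThan_Suc by (simp only: mult.commute)
  qed
  have "{\<omega> \<in> space (PiM UNIV M). \<forall>i<n. \<omega> i = x i} = PF.emb UNIV {0..<n} {restrict x {0..<n}}"
    by (auto simp: prod_emb_def space_PiM PiE_iff fun_eq_iff restrict_def split: if_splits)
  then have "emeasure PF.lim {\<omega> \<in> space (PiM UNIV M). \<forall>i<n. \<omega> i = x i} =
      emeasure (CI {0..<n}) {restrict x {0..<n}}"
    using lim[OF _ sets[of n]] by simp
  also have "\<dots> = emeasure (C 0 n (\<lambda>_. undefined)) {restrict x {0..<n}}"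
    using emeasure_CI[OF order.refl sets[OF order.refl]] mem[OF order.refl]
    by (subst (asm) prod_emb_id) (auto simp: space_PiM)
  finally show ?thesis using C[of n] by simp
qed

text \<open>The Ionescu-Tulcea construction is applied to kernels that read only the preceding
  coordinate. The prefix formula records the full joint law needed for conditioning on
  histories.\<close>

lemma markov_chain_exists:
  fixes K :: "'b \<Rightarrow> 'b pmf"
  assumes a: "a \<in> R" and K: "\<And>x. x \<in> R \<Longrightarrow> set_pmf (K x) \<subseteq> R"
  obtains M :: "(nat \<Rightarrow> 'b) measure" where "prob_space M"
    and "\<And>n. (\<lambda>\<omega>. \<omega> n) \<in> M \<rightarrow>\<^sub>M count_space R"
    and "\<And>n x. (\<And>i. i \<le> n \<Longrightarrow> x i \<in> R) \<Longrightarrow>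
      measure M {\<omega> \<in> space M. \<forall>i\<le>n. \<omega> i = x i} =
      indicator {a} (x 0) * (\<Prod>i<n. pmf (K (x i)) (x (Suc i)))"
proof -
  \<comment> \<open>Kernel 0 is the initial point mass; kernel \<open>i > 0\<close> is the
    transition from coordinate \<open>i - 1\<close>.\<close>
  define k where "k i \<omega> = (if i = 0 then return_pmf a else K (\<omega> (i - 1)))"
    for i :: nat and \<omega> :: "nat \<Rightarrow> 'b"
  \<comment> \<open>A pmf lives on the whole type, whereas the coordinate spaces are
    \<open>count_space R\<close>; restriction loses no mass when the support lies in
    \<open>R\<close>.\<close>
  define P where "P i \<omega> = restrict_space (measure_pmf (k i \<omega>)) R" for i \<omega>
  have sub: "restrict_space (measure_pmf p) R \<in> space (subprob_algebra (count_space R))"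
    and prob: "prob_space (restrict_space (measure_pmf p) R)" if "set_pmf p \<subseteq> R" for p
  proof -
    have "emeasure (measure_pmf p) R = 1"
      using that by (simp add: measure_pmf.emeasure_eq_1_AE AE_measure_pmf_iff subset_iff)
    then show "prob_space (restrict_space (measure_pmf p) R)"
      by (intro prob_spaceI) (simp add: emeasure_restrict_space space_restrict_space)
    then show "restrict_space (measure_pmf p) R \<in> space (subprob_algebra (count_space R))"
      by (auto simp: space_subprob_algebra prob_space_imp_subprob_space sets_restrict_space)
  qed
  have k: "set_pmf (k i \<omega>) \<subseteq> R" if "\<omega> \<in> space (PiM {0..<i} (\<lambda>_. count_space R))" for i \<omega>
  proof (cases i)
    case (Suc j)
    with that have "\<omega> j \<in> R" by (auto simp: space_PiM)
    with K Suc show ?thesis by (simp add: k_def)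
  qed (simp add: k_def a)
  interpret Ionescu_Tulcea P "\<lambda>_. count_space R"
  proof (rule Ionescu_Tulcea.intro)
    fix i
    show "P i \<in> PiM {0..<i} (\<lambda>_. count_space R) \<rightarrow>\<^sub>M subprob_algebra (count_space R)"
    proof (cases i)
      case 0
      then show ?thesis using sub[of "return_pmf a"] a by (simp add: P_def[abs_def] k_def)
    next
      case (Suc j)
      have "(\<lambda>\<omega>. \<omega> j) \<in> PiM {0..<i} (\<lambda>_. count_space R) \<rightarrow>\<^sub>M count_space R"
        using Suc by (intro measurable_component_singleton) simp
      moreover have "(\<lambda>x. restrict_space (measure_pmf (K x)) R)
          \<in> count_space R \<rightarrow>\<^sub>M subprob_algebra (count_space R)"
        using sub K by simp
      ultimately have "(\<lambda>\<omega>. restrict_space (measure_pmf (K (\<omega> j))) R)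
          \<in> PiM {0..<i} (\<lambda>_. count_space R) \<rightarrow>\<^sub>M subprob_algebra (count_space R)"
        by (rule measurable_compose)
      with Suc show ?thesis by (simp add: P_def[abs_def] k_def)
    qed
  qed (simp add: P_def k prob)
  have sp: "space PF.lim = space (PiM UNIV (\<lambda>_. count_space R))"
    by (rule sets_eq_imp_space_eq[OF PF.sets_lim])
  have prefix: "measure PF.lim {\<omega> \<in> space PF.lim. \<forall>i\<le>n. \<omega> i = x i} =
      indicator {a} (x 0) * (\<Prod>i<n. pmf (K (x i)) (x (Suc i)))"
    if x: "\<And>i. i \<le> n \<Longrightarrow> x i \<in> R" for n x
  proof -
    have "emeasure PF.lim {\<omega> \<in> space PF.lim. \<forall>i<Suc n. \<omega> i = x i} =
        (\<Prod>i<Suc n. emeasure (P i (restrict x {0..<i})) {x i})"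
      unfolding sp using x by (intro emeasure_lim_prefix) auto
    also have "\<dots> = (\<Prod>i<Suc n. ennreal (pmf (k i x) (x i)))"
    proof (rule prod.cong)
      fix i assume "i \<in> {..<Suc n}"
      then have "emeasure (P i x) {x i} = ennreal (pmf (k i x) (x i))"
        using x[of i] by (simp add: P_def emeasure_restrict_space emeasure_pmf_single)
      \<comment> \<open>For \<open>i > 0\<close> the coordinate read is \<open>i - 1\<close>, which
        lies in \<open>{0..<i}\<close>; for \<open>i = 0\<close> none is read.\<close>
      moreover have "k i (restrict x {0..<i}) = k i x" by (simp add: k_def)
      ultimately show "emeasure (P i (restrict x {0..<i})) {x i} = ennreal (pmf (k i x) (x i))"
        by (simp add: P_def)
    qed simp
    also have "\<dots> = ennreal (\<Prod>i<Suc n. pmf (k i x) (x i))"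
      by (rule prod_ennreal) simp
    finally have "measure PF.lim {\<omega> \<in> space PF.lim. \<forall>i<Suc n. \<omega> i = x i} =
        (\<Prod>i<Suc n. pmf (k i x) (x i))"
      by (simp add: measure_def prod_nonneg del: prod.lessThan_Suc)
    also have "\<dots> = indicator {a} (x 0) * (\<Prod>i<n. pmf (K (x i)) (x (Suc i)))"
      unfolding prod.lessThan_Suc_shift by (simp add: k_def indicator_def)
    finally show ?thesis by (simp add: less_Suc_eq_le)
  qed
  \<comment> \<open>Total mass 1 is read off at the empty index set, whose cylinder is the whole
    space.\<close>
  let ?S = "space (PiM {} (\<lambda>_. count_space R))"
  have "PF.emb UNIV {} ?S = space PF.lim"
    unfolding sp prod_emb_def space_PiM by auto
  then have "emeasure PF.lim (space PF.lim) = emeasure (CI {}) ?S"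
    using lim[of "{}" ?S] by simp
  also have "?S = space (CI {})"
    by (simp add: CI_def)
  also have "emeasure (CI {}) (space (CI {})) = 1"
    by (rule prob_space.emeasure_space_1[OF PF.prob_space_P]) simp_all
  finally have "emeasure PF.lim (space PF.lim) = 1" .
  then have "prob_space PF.lim" by (rule prob_spaceI)
  moreover have "(\<lambda>\<omega>. \<omega> n) \<in> PF.lim \<rightarrow>\<^sub>M count_space R" for n
    using measurable_component_singleton[of n UNIV "\<lambda>_. count_space R"]
    by (simp add: measurable_cong_sets[OF PF.sets_lim refl])
  ultimately show ?thesis using prefix by (rule that)
qed

section \<open>Deletion to a uniformly chosen tree\<close>

definition uniform_deletion :: "real \<Rightarrow> deletion_matrices" where
  "uniform_deletion q k s t = q / fact k"

text \<open>The law of the next tree given that a deletion occurs; the factor \<open>q\<close>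
  enters through the coin in \<open>growth_kernel\<close>.\<close>

definition uniform_deletion_kernel :: "labeled_tree \<Rightarrow> labeled_tree pmf" where
  "uniform_deletion_kernel s =
     (case stratum_number s of 0 \<Rightarrow> return_pmf s | Suc k \<Rightarrow> pmf_of_set (stratum k))"

definition growth_kernel :: "real \<Rightarrow> labeled_tree \<Rightarrow> labeled_tree pmf" where
  "growth_kernel p s = bernoulli_pmf p \<bind>
     (\<lambda>b. if b then uniform_attachment s else uniform_deletion_kernel s)"

lemma pmf_growth_kernel:
  assumes "0 \<le> p" "p \<le> 1"
  shows "pmf (growth_kernel p s) t =
    transition_prob p (1 - p) (uniform_deletion (1 - p)) s t"
proof -
  have "(1 - p) * pmf (uniform_deletion_kernel s) t =
      deletion_prob (1 - p) (uniform_deletion (1 - p)) s t"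
    by (auto simp: uniform_deletion_kernel_def deletion_prob_def uniform_deletion_def card_stratum
        finite_stratum stratum_nonempty indicator_def split: nat.split)
  then show ?thesis
    using assms by (simp add: growth_kernel_def transition_prob_def pmf_bind mult.commute)
qed

lemma set_pmf_growth_kernel:
  assumes "recursive_tree s"
  shows "set_pmf (growth_kernel p s) \<subseteq> {t. recursive_tree t}"
proof -
  have "set_pmf (uniform_attachment s) \<subseteq> {t. recursive_tree t}"
    using set_pmf_uniform_attachment[OF recursive_tree_stratum[OF assms]] recursive_treeD by blast
  moreover have "set_pmf (uniform_deletion_kernel s) \<subseteq> {t. recursive_tree t}"
    using assms by (auto simp: uniform_deletion_kernel_def finite_stratum stratum_nonempty
        recursive_treeD split: nat.split)
  ultimately show ?thesis by (auto simp: growth_kernel_def split: if_splits)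
qed

lemma deletion_rule_uniform_deletion: "0 \<le> q \<Longrightarrow> deletion_rule q (uniform_deletion q)"
  by (simp add: deletion_rule_def uniform_deletion_def card_stratum)

lemma equal_column_sums_uniform_deletion: "equal_column_sums (uniform_deletion q) k"
  by (simp add: equal_column_sums_def uniform_deletion_def)

text \<open>The coordinate process of the constructed chain serves: each conditional probability is
  a quotient of two prefix probabilities, in which all factors but the last cancel.\<close>

lemma growth_algorithm_uniform_deletion_exists:
  assumes p: "0 \<le> p" "p \<le> 1"
  obtains M :: "(nat \<Rightarrow> labeled_tree) measure"
  where "growth_algorithm p (1 - p) (uniform_deletion (1 - p)) M (\<lambda>n \<omega>. \<omega> n)"
proof -
  have root: "single_node \<in> {t. recursive_tree t}"
    using recursive_treeD[of single_node 0] by (simp add: stratum_0)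
  have kernel: "set_pmf (growth_kernel p x) \<subseteq> {t. recursive_tree t}"
    if "x \<in> {t. recursive_tree t}" for x
    using that set_pmf_growth_kernel by simp
  show ?thesis
  proof (rule markov_chain_exists[OF root kernel])
    fix M :: "(nat \<Rightarrow> labeled_tree) measure"
    assume M: "prob_space M"
      and meas: "\<And>n. (\<lambda>\<omega>. \<omega> n) \<in> M \<rightarrow>\<^sub>M count_space {t. recursive_tree t}"
      and prefix: "\<And>n x. (\<And>i. i \<le> n \<Longrightarrow> x i \<in> {t. recursive_tree t}) \<Longrightarrow>
        measure M {\<omega> \<in> space M. \<forall>i\<le>n. \<omega> i = x i} =
        indicator {single_node} (x 0) * (\<Prod>i<n. pmf (growth_kernel p (x i)) (x (Suc i)))"
    interpret prob_space M by fact
    have "prob {\<omega> \<in> space M. \<omega> 0 = single_node} = 1"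
      using prefix[of 0 "\<lambda>_. single_node"] root by simp
    then have "AE \<omega> in M. \<omega> \<in> {\<omega> \<in> space M. \<omega> 0 = single_node}"
      by (rule AE_prob_1)
    then have "AE \<omega> in M. \<omega> 0 = single_node"
      by (auto elim: eventually_mono)
    moreover have "cond_prob M (\<lambda>\<omega>. \<omega> (Suc n) = y) (\<lambda>\<omega>. \<forall>i\<le>n. \<omega> i = x i) =
        transition_prob p (1 - p) (uniform_deletion (1 - p)) (x n) y"
      if y: "recursive_tree y" and pos: "0 < prob {\<omega> \<in> space M. \<forall>i\<le>n. \<omega> i = x i}" for n x y
    proof -
      \<comment> \<open>A history of positive probability is realised by some
        \<open>\<omega>\<close>, so all its trees are recursive and the prefix formula
        applies.\<close>
      from pos have "{\<omega> \<in> space M. \<forall>i\<le>n. \<omega> i = x i} \<noteq> {}"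
        by (metis less_irrefl measure_empty)
      then obtain \<omega> where "\<omega> \<in> space M" "\<forall>i\<le>n. \<omega> i = x i" by blast
      then have x: "x i \<in> {t. recursive_tree t}" if "i \<le> n" for i
        using measurable_space[OF meas[of i], of \<omega>] that by simp
      have "{\<omega> \<in> space M. \<omega> (Suc n) = y \<and> (\<forall>i\<le>n. \<omega> i = x i)} =
          {\<omega> \<in> space M. \<forall>i\<le>Suc n. \<omega> i = (x(Suc n := y)) i}"
        by (auto simp: le_Suc_eq)
      moreover have "prob {\<omega> \<in> space M. \<forall>i\<le>Suc n. \<omega> i = (x(Suc n := y)) i} =
          prob {\<omega> \<in> space M. \<forall>i\<le>n. \<omega> i = x i} * pmf (growth_kernel p (x n)) y"
      proof -
        \<comment> \<open>The first \<open>n\<close> factors involve only indices up to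
          \<open>n\<close>, which the update at \<open>Suc n\<close> leaves alone.\<close>
        have "(\<Prod>i<n. pmf (growth_kernel p ((x(Suc n := y)) i)) ((x(Suc n := y)) (Suc i))) =
            (\<Prod>i<n. pmf (growth_kernel p (x i)) (x (Suc i)))"
          by (rule prod.cong) auto
        then show ?thesis
          using prefix[of n x] prefix[of "Suc n" "x(Suc n := y)"] x y
          by (simp del: fun_upd_apply) simp
      qed
      ultimately show ?thesis
        using pos pmf_growth_kernel[OF p] by (simp add: cond_prob_def)
    qed
    ultimately have "growth_algorithm p (1 - p) (uniform_deletion (1 - p)) M (\<lambda>n \<omega>. \<omega> n)"
      unfolding growth_algorithm_def using M meas by blast
    then show thesis by (rule that)
  qed
qed

theorem corollary2p1p1:
  fixes p q :: real
  assumes "0 < p" and "p < 1" and "q = 1 - p"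
  shows "(\<forall>Q (M :: 'a measure) T.
            deletion_rule q Q \<and> growth_algorithm p q Q M T \<and> (\<forall>k. equal_column_sums Q k)
              \<longrightarrow> conditionally_equiprobable M T) \<and>
         (\<forall>Q (M :: 'a measure) T.
            deletion_rule q Q \<and> growth_algorithm p q Q M T \<and> conditionally_equiprobable M T
              \<longrightarrow> (\<forall>k. equal_column_sums Q k)) \<and>
         (\<exists>Q (M :: (nat \<Rightarrow> labeled_tree) measure) T.
            deletion_rule q Q \<and> growth_algorithm p q Q M T \<and> conditionally_equiprobable M T)"
proof (intro conjI allI impI; (elim conjE)?)
  fix Q T and M :: "'a measure"
  assume "deletion_rule q Q" "growth_algorithm p q Q M T"
  with assms interpret growth_chain p q Q M T by unfold_locales auto
  show "conditionally_equiprobable M T" if "\<forall>k. equal_column_sums Q k"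
    using that by (rule conditionally_equiprobable_if_equal_column_sums)
  show "equal_column_sums Q k" if "conditionally_equiprobable M T" for k
    using that by (rule equal_column_sums_if_conditionally_equiprobable)
next
  \<comment> \<open>Nonemptiness follows from the first implication, applied to uniform
    deletion.\<close>
  obtain M :: "(nat \<Rightarrow> labeled_tree) measure"
    where M: "growth_algorithm p q (uniform_deletion q) M (\<lambda>n \<omega>. \<omega> n)"
    using growth_algorithm_uniform_deletion_exists[of p] assms by auto
  with assms interpret growth_chain p q "uniform_deletion q" M "\<lambda>n \<omega>. \<omega> n"
    by unfold_locales (auto simp: deletion_rule_uniform_deletion)
  show "\<exists>Q (M :: (nat \<Rightarrow> labeled_tree) measure) T.
      deletion_rule q Q \<and> growth_algorithm p q Q M T \<and> conditionally_equiprobable M T"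
    using rule M conditionally_equiprobable_if_equal_column_sums
      equal_column_sums_uniform_deletion by blast
qed

end
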